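(* Let $\sigma\in\{-,+\}^n$ be a periodic slope itinerary of length $n$ containing more than one $-$, and let $H$ be a non-empty connected component of the set of parameters $(a,b)\in\mathcal P=\mathbb R/\mathbb Z\times[0,1]$ for which $f_{a,b}$ has an attracting periodic cycle of period $n$ with periodic slope itinerary $\sigma$. Then $H$ is an eye, i.e. $\overline H$ does not intersect $\mathbb T\times\{1\}$ in a nontrivial (non-degenerate) interval.
   Context: Let $\mathbb T=\mathbb R/\mathbb Z$, identified with $[0,1]$ with $0\sim 1$. For $(a,b)\in\mathcal P=\mathbb R/\mathbb Z\times[0,1]$ define $f_{a,b}:\mathbb T\to\mathbb T$ by $f_{a,b}(x)=\left(2x+a+\frac b2 S(x)\right)\bmod 1$, where $S(x)=4x-1$ for $x\in[0,\frac12]$ and $S(x)=-4x+3$ for $x\in[\frac12,1)$. Write $I_+=[0,\frac12]$, $I_-=[\frac12,1]$. For a periodic orbit $x_0,\dots,x_{n-1}$ (with $x_{j+1}=f_{a,b}(x_j)$) of exact period $n$ avoiding $0$ and $\frac12$, its periodic slope itinerary is $\sigma=(\sigma_0,\dots,\sigma_{n-1})\in\{-,+\}^n$ with $x_j\in I_{\sigma_j}$ (for a suitable choice of starting point). A periodic cycle of period $n$ is attracting if each of its points has a neighbourhood all of whose points converge to it under iteration of $f_{a,b}^n$. A connected component $S$ of the set of parameters corresponding to attracting cycles with periodic slope itinerary $\sigma$ is called a tongue if $\overline S$ intersects $\mathbb T\times\{1\}$ in a nontrivial interval; otherwise it is called an eye. *)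

theory Defs
  imports "HOL-Analysis.Analysis"
begin

text \<open>The circle \<open>\<real>/\<int>\<close> with the quotient topology.\<close>

quotient_type circle = real / "\<lambda>x y::real. x - y \<in> \<int>"
proof (rule equivpI)
  show "reflp (\<lambda>x y::real. x - y \<in> \<int>)"
    by (simp add: reflp_def)
  show "symp (\<lambda>x y::real. x - y \<in> \<int>)"
  proof (rule sympI)
    fix x y :: real
    assume "x - y \<in> \<int>"
    then have "- (x - y) \<in> \<int>" by (rule Ints_minus)
    then show "y - x \<in> \<int>" by simp
  qed
  show "transp (\<lambda>x y::real. x - y \<in> \<int>)"
  proof (rule transpI)
    fix x y z :: real
    assume "x - y \<in> \<int>" "y - z \<in> \<int>"
    then have "(x - y) + (y - z) \<in> \<int>" by (rule Ints_add)
    then show "x - z \<in> \<int>" by simp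
  qed
qed

lift_definition to_circle :: "real \<Rightarrow> circle" is "\<lambda>x. x" .

text \<open>The representative in \<open>[0,1)\<close>.\<close>

lift_definition coord :: "circle \<Rightarrow> real" is frac
proof -
  fix x y :: real
  assume "x - y \<in> \<int>"
  then obtain k :: int where "x - y = of_int k"
    by (rule Ints_cases)
  then have "x = y + of_int k"
    by simp
  then show "frac x = frac y"
    by (simp add: frac_def)
qed

lemma to_circle_eq_iff: "to_circle x = to_circle y \<longleftrightarrow> x - y \<in> \<int>"
  by transfer simp

lemma coord_to_circle: "coord (to_circle x) = frac x"
  by transfer simp

lemma to_circle_coord: "to_circle (coord x) = x"
  by transfer (simp add: frac_def)

instantiation circle :: topological_space
begin

definition open_circle :: "circle set \<Rightarrow> bool"
  where "open_circle U \<longleftrightarrow> open (to_circle -` U)"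

instance
  by standard (auto simp: open_circle_def vimage_Union open_Int)

end

definition saw :: "real \<Rightarrow> real"
  where "saw x = (if x \<le> 1/2 then 4 * x - 1 else - 4 * x + 3)"

definition fmap :: "circle \<Rightarrow> real \<Rightarrow> circle \<Rightarrow> circle"
  where "fmap a b x = to_circle (2 * coord x + coord a + b / 2 * saw (coord x))"

datatype slope = Minus | Plus

text \<open>Both arcs are closed: they share the points \<open>0\<close> and \<open>1/2\<close> of the circle.\<close>

fun slope_arc :: "slope \<Rightarrow> circle set"
  where
    "slope_arc Plus = to_circle ` {0..1/2}"
  | "slope_arc Minus = to_circle ` {1/2..1}"

definition exact_period :: "('a \<Rightarrow> 'a) \<Rightarrow> nat \<Rightarrow> 'a \<Rightarrow> bool"
  where "exact_period f n x \<longleftrightarrow>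
    n > 0 \<and> (f ^^ n) x = x \<and> (\<forall>k. 0 < k \<and> k < n \<longrightarrow> (f ^^ k) x \<noteq> x)"

definition attracting_cycle :: "('a::topological_space \<Rightarrow> 'a) \<Rightarrow> nat \<Rightarrow> 'a \<Rightarrow> bool"
  where "attracting_cycle f n x \<longleftrightarrow> exact_period f n x \<and>
    (\<forall>j<n. \<exists>U. open U \<and> (f ^^ j) x \<in> U \<and>
       (\<forall>y\<in>U. (\<lambda>k. ((f ^^ n) ^^ k) y) \<longlonglongrightarrow> (f ^^ j) x))"

text \<open>The starting point \<open>x\<close> of the cycle is the one from which \<open>\<sigma>\<close> is read off.\<close>

definition slope_itinerary :: "(circle \<Rightarrow> circle) \<Rightarrow> nat \<Rightarrow> circle \<Rightarrow> slope list \<Rightarrow> bool"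
  where "slope_itinerary f n x \<sigma> \<longleftrightarrow> exact_period f n x \<and> length \<sigma> = n \<and>
    (\<forall>j<n. (f ^^ j) x \<notin> {to_circle 0, to_circle (1/2)} \<and> (f ^^ j) x \<in> slope_arc (\<sigma> ! j))"

definition param_space :: "(circle \<times> real) set"
  where "param_space = UNIV \<times> {0..1}"

definition attracting_params :: "nat \<Rightarrow> slope list \<Rightarrow> (circle \<times> real) set"
  where "attracting_params n \<sigma> =
    {(a, b) \<in> param_space.
       \<exists>x. attracting_cycle (fmap a b) n x \<and> slope_itinerary (fmap a b) n x \<sigma>}"

text \<open>A set meets \<open>\<real>/\<int> \<times> {1}\<close> in a nontrivial interval if the intersection contains an arc
  with more than one point.  The parameter space is closed in \<open>circle \<times> real\<close>, so
  closures may be taken in the latter.\<close>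

definition meets_top_in_interval :: "(circle \<times> real) set \<Rightarrow> bool"
  where "meets_top_in_interval K \<longleftrightarrow>
    (\<exists>u v::real. u < v \<and> to_circle ` {u..v} \<times> {1} \<subseteq> K \<inter> (UNIV \<times> {1}))"

definition tongue :: "nat \<Rightarrow> slope list \<Rightarrow> (circle \<times> real) set \<Rightarrow> bool"
  where "tongue n \<sigma> S \<longleftrightarrow>
    S \<in> components (attracting_params n \<sigma>) \<and> meets_top_in_interval (closure S)"

definition eye :: "nat \<Rightarrow> slope list \<Rightarrow> (circle \<times> real) set \<Rightarrow> bool"
  where "eye n \<sigma> S \<longleftrightarrow>
    S \<in> components (attracting_params n \<sigma>) \<and> \<not> meets_top_in_interval (closure S)"

end

theory Submission
  imports Defs
begin

text \<open>
  On the arc \<open>I\<^sub>-\<close> the map \<open>f\<close> has slope \<open>2 - 2b\<close>, and everywhere it stretches distances by at most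
  \<open>4\<close>. Hence \<open>f\<^sup>n\<close>, restricted to \<open>I\<^sub>-\<close>, is Lipschitz with constant \<open>4\<^bsup>n-1\<^esup> (2 - 2b)\<close>. For \<open>b\<close>
  close to \<open>1\<close> this constant is below \<open>1\<close>, so that \<open>f\<^sup>n\<close> has at most one fixed point in \<open>I\<^sub>-\<close>. A
  cycle of exact period \<open>n\<close> whose itinerary contains two minus signs would provide two of them
  (\<open>Lipschitz_bound_if_two_Minus\<close>). So all parameters with such a cycle satisfy
  \<open>1 \<le> 4\<^bsup>n-1\<^esup> (2 - 2b)\<close>, a closed condition that excludes \<open>b = 1\<close>: the closure of the parameter
  set does not even touch the top boundary.

  Distances are measured on the real line, by means of the lift
  \<open>x \<mapsto> 2x + a + b/2 (4 dist(x, \<int>) - 1)\<close> of \<open>f\<close>. Writing the sawtooth through the distance to the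
  integers makes it periodic and continuous at once, so that the global bound \<open>2 + 2b \<le> 4\<close> on the
  stretching needs no case distinction along the orbit.
\<close>

definition dist_Ints :: "real \<Rightarrow> real"
  where "dist_Ints x = \<bar>x - of_int (round x)\<bar>"

definition fmap_lift :: "real \<Rightarrow> real \<Rightarrow> real \<Rightarrow> real"
  where "fmap_lift a b x = 2 * x + a + b / 2 * (4 * dist_Ints x - 1)"

lemma dist_Ints_le: "dist_Ints x \<le> \<bar>x - of_int k\<bar>"
  unfolding dist_Ints_def by (rule round_diff_minimal)

lemma dist_Ints_lipschitz: "\<bar>dist_Ints x - dist_Ints y\<bar> \<le> \<bar>x - y\<bar>"
  using dist_Ints_le[of x "round y"] dist_Ints_le[of y "round x"]
  unfolding dist_Ints_def by linarith

lemma dist_Ints_upper_half: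
  assumes "1/2 \<le> x" "x \<le> 1"
  shows "dist_Ints x = 1 - x"
proof (rule antisym)
  show "dist_Ints x \<le> 1 - x"
    using dist_Ints_le[of x 1] assms by simp
  have "round x \<le> 0 \<or> 1 \<le> round x" by linarith
  then have "real_of_int (round x) \<le> 0 \<or> 1 \<le> real_of_int (round x)" by simp
  then show "1 - x \<le> dist_Ints x"
    unfolding dist_Ints_def using assms by linarith
qed

lemma saw_frac: "saw (frac x) = 4 * dist_Ints x - 1"
proof -
  have fl: "x = of_int \<lfloor>x\<rfloor> + frac x" by (simp add: frac_def)
  have fr: "0 \<le> frac x" "frac x < 1" by (simp_all add: frac_lt_1)
  have "dist_Ints x \<le> frac x" "dist_Ints x \<le> 1 - frac x"
    using dist_Ints_le[of x "\<lfloor>x\<rfloor>"] dist_Ints_le[of x "\<lfloor>x\<rfloor> + 1"] fl fr by auto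
  moreover have "frac x \<le> dist_Ints x \<or> 1 - frac x \<le> dist_Ints x"
  proof -
    have "round x \<le> \<lfloor>x\<rfloor> \<or> \<lfloor>x\<rfloor> + 1 \<le> round x" by linarith
    then have "real_of_int (round x) \<le> of_int \<lfloor>x\<rfloor> \<or> of_int \<lfloor>x\<rfloor> + 1 \<le> real_of_int (round x)"
      by linarith
    then show ?thesis
      unfolding dist_Ints_def using fl by linarith
  qed
  ultimately show ?thesis by (auto simp: saw_def)
qed

lemma to_circle_fmap_lift: "to_circle (fmap_lift (coord a) b x) = fmap a b (to_circle x)"
proof -
  have "fmap_lift (coord a) b x
      - (2 * frac x + coord a + b / 2 * (4 * dist_Ints x - 1)) = of_int (2 * \<lfloor>x\<rfloor>)"
    by (simp add: fmap_lift_def frac_def)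
  then show ?thesis
    by (simp add: fmap_def coord_to_circle saw_frac to_circle_eq_iff)
qed

lemma to_circle_funpow_fmap_lift:
  "to_circle ((fmap_lift (coord a) b ^^ k) x) = (fmap a b ^^ k) (to_circle x)"
  by (induction k) (simp_all add: to_circle_fmap_lift)

lemma fmap_lift_lipschitz:
  assumes "0 \<le> b" "b \<le> 1"
  shows "\<bar>fmap_lift a b x - fmap_lift a b y\<bar> \<le> 4 * \<bar>x - y\<bar>"
proof -
  have "fmap_lift a b x - fmap_lift a b y = 2 * (x - y) + 2 * (b * (dist_Ints x - dist_Ints y))"
    by (simp add: fmap_lift_def algebra_simps)
  moreover have "\<bar>b * (dist_Ints x - dist_Ints y)\<bar> \<le> 1 * \<bar>x - y\<bar>"
    unfolding abs_mult using assms by (intro mult_mono dist_Ints_lipschitz) auto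
  ultimately show ?thesis by linarith
qed

lemma funpow_fmap_lift_lipschitz:
  assumes "0 \<le> b" "b \<le> 1"
  shows "\<bar>(fmap_lift a b ^^ k) x - (fmap_lift a b ^^ k) y\<bar> \<le> 4 ^ k * \<bar>x - y\<bar>"
proof (induction k)
  case (Suc k)
  then show ?case
    using fmap_lift_lipschitz[OF assms, of a "(fmap_lift a b ^^ k) x" "(fmap_lift a b ^^ k) y"]
    by simp
qed simp

lemma fmap_lift_diff_upper_half:
  assumes "x \<in> {1/2..1}" "y \<in> {1/2..1}"
  shows "fmap_lift a b x - fmap_lift a b y = (2 - 2 * b) * (x - y)"
  using assms by (simp add: fmap_lift_def dist_Ints_upper_half algebra_simps)

text \<open>Two fixed points of \<open>f\<^sup>n\<close> in \<open>I\<^sub>-\<close> have lifts \<open>z, w\<close> at distance at most \<open>1/2\<close>. A contraction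
  moves the images under the lift of \<open>f\<^sup>n\<close> closer still, and these images differ from \<open>z, w\<close> by
  integers. The two integers must then coincide, and the contraction preserves the distance of
  \<open>z\<close> and \<open>w\<close>, so \<open>z = w\<close>.\<close>

lemma fixed_point_in_Minus_arc_unique:
  assumes b: "0 \<le> b" "b \<le> 1" and small: "4 ^ m * (2 - 2 * b) < 1"
    and p: "p \<in> slope_arc Minus" "(fmap a b ^^ Suc m) p = p"
    and q: "q \<in> slope_arc Minus" "(fmap a b ^^ Suc m) q = q"
  shows "p = q"
proof -
  let ?F = "fmap_lift (coord a) b"
  obtain z w where z: "z \<in> {1/2..1}" "p = to_circle z" and w: "w \<in> {1/2..1}" "q = to_circle w"
    using p(1) q(1) by auto
  let ?D = "(?F ^^ Suc m) z - (?F ^^ Suc m) w"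
  have "(?F ^^ Suc m) z - z \<in> \<int>" "(?F ^^ Suc m) w - w \<in> \<int>"
    using p(2) q(2)
    by (simp_all only: z(2) w(2) flip: to_circle_eq_iff to_circle_funpow_fmap_lift)
  then have "((?F ^^ Suc m) z - z) - ((?F ^^ Suc m) w - w) \<in> \<int>"
    by (rule Ints_diff)
  then obtain k :: int where "((?F ^^ Suc m) z - z) - ((?F ^^ Suc m) w - w) = of_int k"
    by (rule Ints_cases)
  then have k: "?D = z - w + of_int k" by linarith
  have "\<bar>?D\<bar> \<le> 4 ^ m * \<bar>?F z - ?F w\<bar>"
    using funpow_fmap_lift_lipschitz[OF b, of m "coord a" "?F z" "?F w"]
    by (simp add: funpow_swap1)
  also have "\<dots> = 4 ^ m * (2 - 2 * b) * \<bar>z - w\<bar>"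
    using b by (simp add: fmap_lift_diff_upper_half[OF z(1) w(1)] abs_mult)
  finally have D: "\<bar>?D\<bar> \<le> 4 ^ m * (2 - 2 * b) * \<bar>z - w\<bar>" .
  show "p = q"
  proof (rule ccontr)
    assume "p \<noteq> q"
    then have "0 < \<bar>z - w\<bar>" using z w by auto
    then have "4 ^ m * (2 - 2 * b) * \<bar>z - w\<bar> < \<bar>z - w\<bar>"
      using mult_strict_right_mono[OF small] by (simp only: mult_1)
    with D have less: "\<bar>?D\<bar> < \<bar>z - w\<bar>" by (rule le_less_trans)
    moreover have "\<bar>z - w\<bar> \<le> 1/2" using z(1) w(1) unfolding atLeastAtMost_iff by linarith
    ultimately have "\<bar>of_int k :: real\<bar> < 1" using k by linarith
    then have "k = 0" by linarith
    then show False using k less by simp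
  qed
qed

lemma exact_period_inj_on:
  assumes "exact_period f n x"
  shows "inj_on (\<lambda>i. (f ^^ i) x) {..<n}"
proof (rule linorder_inj_onI')
  fix i j assume "i \<in> {..<n}" "j \<in> {..<n}" "i < j"
  then have n: "n = (n - j) + j" "0 < n - j + i" "n - j + i < n" by auto
  show "(f ^^ i) x \<noteq> (f ^^ j) x"
  proof
    assume "(f ^^ i) x = (f ^^ j) x"
    then have "(f ^^ (n - j + i)) x = (f ^^ (n - j + j)) x"
      by (simp only: funpow_add o_apply)
    then have "(f ^^ (n - j + i)) x = x"
      using n assms by (simp add: exact_period_def)
    then show False using n assms by (auto simp: exact_period_def)
  qed
qed

lemma two_occurrences:
  assumes "count_list xs c > 1"
  obtains i j where "i < length xs" "j < length xs" "i \<noteq> j" "xs ! i = c" "xs ! j = c"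
proof -
  let ?I = "{i. i < length xs \<and> xs ! i = c}"
  have "card ?I = count_list xs c"
    by (simp add: count_list_eq_length_filter length_filter_conv_card eq_commute)
  then have "\<not> (\<forall>i\<in>?I. \<forall>j\<in>?I. i = j)"
    using assms card_le_Suc0_iff_eq[of ?I] by auto
  then show ?thesis using that by blast
qed

text \<open>The two visits of the cycle to \<open>I\<^sub>-\<close> happen at different points because the period is exact.\<close>

lemma Lipschitz_bound_if_two_Minus:
  assumes b: "0 \<le> b" "b \<le> 1" and it: "slope_itinerary (fmap a b) n x \<sigma>"
    and "count_list \<sigma> Minus > 1"
  shows "1 \<le> 4 ^ (n - 1) * (2 - 2 * b)"
proof (rule ccontr)
  assume "\<not> ?thesis"
  then have small: "4 ^ (n - 1) * (2 - 2 * b) < 1" by simp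
  let ?f = "fmap a b"
  obtain i j where ij: "i < n" "j < n" "i \<noteq> j" "\<sigma> ! i = Minus" "\<sigma> ! j = Minus"
    using two_occurrences[OF assms(4)] it by (auto simp: slope_itinerary_def)
  have per: "exact_period ?f n x" and n: "Suc (n - 1) = n"
    using it by (auto simp: slope_itinerary_def exact_period_def)
  have fixed: "(?f ^^ n) ((?f ^^ l) x) = (?f ^^ l) x" for l
  proof -
    have "(?f ^^ n) ((?f ^^ l) x) = (?f ^^ (n + l)) x" by (simp add: funpow_add)
    also have "\<dots> = (?f ^^ l) ((?f ^^ n) x)" by (subst add.commute) (simp add: funpow_add)
    finally show ?thesis using per by (simp add: exact_period_def)
  qed
  have arc: "(?f ^^ l) x \<in> slope_arc (\<sigma> ! l)" if "l < n" for l
    using it that by (simp add: slope_itinerary_def)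
  have "(?f ^^ i) x \<in> slope_arc Minus" "(?f ^^ j) x \<in> slope_arc Minus"
    using arc[OF ij(1)] arc[OF ij(2)] unfolding ij(4,5) .
  then have "(?f ^^ i) x = (?f ^^ j) x"
    by (rule fixed_point_in_Minus_arc_unique[OF b small, unfolded n, OF _ fixed _ fixed])
  then show False
    using exact_period_inj_on[OF per] ij by (auto simp: inj_on_def)
qed

theorem theorem2p5:
  fixes n :: nat and \<sigma> :: "slope list" and H :: "(circle \<times> real) set"
  assumes "length \<sigma> = n"
    and "count_list \<sigma> Minus > 1"
    and "H \<in> components (attracting_params n \<sigma>)"
    and "H \<noteq> {}"
  shows "eye n \<sigma> H"
proof -
  let ?B = "{b::real. 1 \<le> 4 ^ (n - 1) * (2 - 2 * b)}"
  have "attracting_params n \<sigma> \<subseteq> UNIV \<times> ?B"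
    using Lipschitz_bound_if_two_Minus[OF _ _ _ assms(2)]
    by (auto simp: attracting_params_def param_space_def)
  then have "H \<subseteq> UNIV \<times> ?B"
    using in_components_subset[OF assms(3)] by blast
  moreover have "closed (UNIV \<times> ?B :: (circle \<times> real) set)"
    by (intro closed_Times closed_UNIV closed_Collect_le continuous_intros)
  ultimately have cl: "closure H \<subseteq> UNIV \<times> ?B"
    by (rule closure_minimal)
  have "\<not> meets_top_in_interval (closure H)"
  proof
    assume "meets_top_in_interval (closure H)"
    then obtain u v :: real where "u < v" "to_circle ` {u..v} \<times> {1} \<subseteq> closure H"
      unfolding meets_top_in_interval_def by blast
    then have "(to_circle u, 1) \<in> closure H" by auto
    then show False using cl by auto
  qed
  then show ?thesis using assms(3) by (simp add: eye_def)
qed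

end
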